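(* Let $G$ be a finite group with identity $e$, and let $|\cdot|:G\to\mathbb{R}_{\ge 0}$ be a class function (constant on conjugacy classes) with $|e|=0$ and $|g|=|g^{-1}|$ for all $g\in G$. Let $p_r(t)$ ($r$ ranging over the irreducible complex representations of $G$ up to isomorphism, $t\ge 0$) be the coefficients in the decomposition $P_t=\sum_r p_r(t)\,\sigma_r$ of the semigroup $P_t$ associated with $|\cdot|$. If there exists $\epsilon>0$ such that for all irreps $r$ one has $p_r(t)\ge 0$ for all $0\le t\le\epsilon$, then for every irrep $s$ one has $p_s(t)\ge 0$ for all $t\ge 0$.
   Context: Let $\mathcal{L}G$ be the complex group algebra of $G$ with basis $\{|g\rangle : g\in G\}$ (ket notation for the group element basis). The semigroup $(P_t)_{t\ge 0}$ associated with $|\cdot|$ consists of the linear operators on $\mathcal{L}G$ defined by $P_t|g\rangle=e^{-t|g|}\,|g\rangle$ (here $|g|$ in the exponent is the value of the function $|\cdot|$ at $g$). For each irreducible complex representation (irrep) $r$ of $G$ with character $\chi_r$, the operator $\sigma_r$ is defined by $\sigma_r|g\rangle=\chi_r(g)\,|g\rangle$. Since $|\cdot|$ is a class function, there are uniquely determined coefficients $p_r(t)$ with $P_t=\sum_r p_r(t)\sigma_r$, i.e. $e^{-t|g|}=\sum_r p_r(t)\chi_r(g)$ for all $g\in G$, the sum running over irreps up to isomorphism. They are real because $|g|=|g^{-1}|$. *)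

theory Defs
  imports
    Complex_Main
    "HOL-Library.Nonpos_Ints"
    "HOL-Algebra.Group"
    "Jordan_Normal_Form.Matrix"
    "Jordan_Normal_Form.VS_Connect"
begin

definition general_linear :: "nat \<Rightarrow> complex mat monoid" where
  "general_linear n = units_of (ring_mat TYPE(complex) n ())"

definition is_rep :: "('g, 'b) monoid_scheme \<Rightarrow> nat \<Rightarrow> ('g \<Rightarrow> complex mat) \<Rightarrow> bool" where
  "is_rep G n \<rho> \<longleftrightarrow> \<rho> \<in> hom G (general_linear n)"

(* Irreps of a finite group over the complex numbers are finite-dimensional, so, up to
   isomorphism, matrix representations cover all of them. *)
definition is_irrep :: "('g, 'b) monoid_scheme \<Rightarrow> ('g \<Rightarrow> complex mat) \<Rightarrow> bool" where
  "is_irrep G \<rho> \<longleftrightarrow>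
     (\<exists>n > 0. is_rep G n \<rho> \<and>
        (\<forall>W. VectorSpace.subspace class_ring W (module_vec TYPE(complex) n) \<and>
              (\<forall>g \<in> carrier G. \<forall>w \<in> W. \<rho> g *\<^sub>v w \<in> W) \<longrightarrow>
              W = {0\<^sub>v n} \<or> W = carrier_vec n))"

(* One pair P, Q of mutually inverse matrices conjugates all the matrices simultaneously. *)
definition rep_iso ::
    "('g, 'b) monoid_scheme \<Rightarrow> ('g \<Rightarrow> complex mat) \<Rightarrow> ('g \<Rightarrow> complex mat) \<Rightarrow> bool" where
  "rep_iso G \<rho> \<tau> \<longleftrightarrow> (\<exists>P Q. \<forall>g \<in> carrier G. similar_mat_wit (\<rho> g) (\<tau> g) P Q)"

(* Exactly one representative of each isomorphism class of irreps. For a finite group such a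
   set is necessarily finite. *)
definition irrep_representatives ::
    "('g, 'b) monoid_scheme \<Rightarrow> ('g \<Rightarrow> complex mat) set \<Rightarrow> bool" where
  "irrep_representatives G R \<longleftrightarrow>
     (\<forall>\<rho> \<in> R. is_irrep G \<rho>) \<and> (\<forall>\<rho>. is_irrep G \<rho> \<longrightarrow> (\<exists>!\<tau>. \<tau> \<in> R \<and> rep_iso G \<rho> \<tau>))"

definition rep_char :: "('g \<Rightarrow> complex mat) \<Rightarrow> 'g \<Rightarrow> complex" where
  "rep_char \<rho> g = (\<Sum>i<dim_row (\<rho> g). \<rho> g $$ (i, i))"

(* An element of the group algebra is given by its coefficient function with respect to the
   basis of group elements. *)
definition group_algebra :: "('g, 'b) monoid_scheme \<Rightarrow> ('g \<Rightarrow> complex) set" where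
  "group_algebra G = {v. \<forall>g. g \<notin> carrier G \<longrightarrow> v g = 0}"

definition ket :: "'g \<Rightarrow> 'g \<Rightarrow> complex" where
  "ket g = (\<lambda>h. if h = g then 1 else 0)"

(* The next two operators are the linear extensions of their values on kets; see the lemmas. *)
definition semigroup_op :: "('g \<Rightarrow> real) \<Rightarrow> real \<Rightarrow> ('g \<Rightarrow> complex) \<Rightarrow> 'g \<Rightarrow> complex" where
  "semigroup_op len t v = (\<lambda>g. of_real (exp (- t * len g)) * v g)"

definition sigma_op :: "('g \<Rightarrow> complex mat) \<Rightarrow> ('g \<Rightarrow> complex) \<Rightarrow> 'g \<Rightarrow> complex" where
  "sigma_op \<rho> v = (\<lambda>g. rep_char \<rho> g * v g)"

lemma semigroup_op_ket:
  "semigroup_op len t (ket g) = (\<lambda>h. of_real (exp (- t * len g)) * ket g h)"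
  by (auto simp: semigroup_op_def ket_def)

lemma sigma_op_ket: "sigma_op \<rho> (ket g) = (\<lambda>h. rep_char \<rho> g * ket g h)"
  by (auto simp: sigma_op_def ket_def)

end

theory Submission
  imports Defs "Jordan_Normal_Form.Schur_Decomposition" "Jordan_Normal_Form.Spectral_Radius"
begin

text \<open>
  Nonnegativity of the coefficients survives the doubling of time. Write \<open>f\<^sub>t g = exp (- t * len g)\<close>, so
  that \<open>f\<^sub>2\<^sub>t = f\<^sub>t * f\<^sub>t\<close> pointwise. If \<open>f\<^sub>t = (\<Sum>a. p\<^sub>a \<chi>\<^sub>a)\<close> with all \<open>p\<^sub>a\<close> nonnegative, then \<open>f\<^sub>2\<^sub>t\<close> is the
  combination of the products \<open>\<chi>\<^sub>a \<chi>\<^sub>b\<close> with the nonnegative weights \<open>p\<^sub>a p\<^sub>b\<close>, and a product of two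
  characters is the character of a tensor product, in which every irrep occurs with a multiplicity
  that is a natural number. So the coefficients at time \<open>2 t\<close> are nonnegative too
  (\<open>square_coefficients_nonneg\<close>), and every time is reached from the interval \<open>[0, \<epsilon>]\<close> by finitely many
  doublings (\<open>nonneg_propagates_by_doubling\<close>).

  The coefficients are read off by pairing with characters: Schur's lemma makes the characters of
  the representatives orthogonal (\<open>representatives_orthogonal\<close>), whence
  \<open>(\<Sum>g. f g * \<chi>\<^sub>s (inv g)) = |G| c\<^sub>s\<close> for \<open>f = (\<Sum>r. c\<^sub>r \<chi>\<^sub>r)\<close>. The multiplicity of \<open>s\<close>
  in \<open>a \<otimes> b\<close> appears as the number \<open>(\<Sum>g. \<chi>\<^sub>a g * \<chi>\<^sub>b g * \<chi>\<^sub>s (inv g)) / |G|\<close>, which is the trace of the average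
  over \<open>G\<close> of the representation \<open>a \<otimes> b \<otimes> s*\<close>. The average is idempotent, and the trace of an idempotent complex matrix is a natural number
  (\<open>trace_idempotent\<close>, \<open>sum_rep_char\<close>).
\<close>

section \<open>Traces and sums of matrices\<close>

definition trace :: "'a::comm_monoid_add mat \<Rightarrow> 'a" where
  "trace A = (\<Sum>i<dim_row A. A $$ (i, i))"

lemma rep_char_eq_trace: "rep_char \<rho> g = trace (\<rho> g)"
  by (simp add: rep_char_def trace_def)

lemma mat_eq_on_vecI:
  fixes A B :: "'a::semiring_1 mat"
  assumes A: "A \<in> carrier_mat n m" and B: "B \<in> carrier_mat n m"
    and eq: "\<And>v. v \<in> carrier_vec m \<Longrightarrow> A *\<^sub>v v = B *\<^sub>v v"
  shows "A = B"
proof (rule eq_matI)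
  fix i j assume "i < dim_row B" "j < dim_col B"
  then show "A $$ (i, j) = B $$ (i, j)"
    using arg_cong[OF eq[OF unit_vec_carrier, of j], of "\<lambda>v. v $ i"] A B by simp
qed (use A B in auto)

lemma smult_one_mat_mult_vec:
  fixes v :: "'a::comm_ring_1 vec"
  assumes "v \<in> carrier_vec n"
  shows "(c \<cdot>\<^sub>m 1\<^sub>m n) *\<^sub>v v = c \<cdot>\<^sub>v v"
  using assms by (intro eq_vecI) (auto simp: row_smult)

lemma mult_mat_zero_vec:
  fixes A :: "'a::semiring_0 mat"
  assumes "A \<in> carrier_mat n m"
  shows "A *\<^sub>v 0\<^sub>v m = 0\<^sub>v n"
  using assms by (intro eq_vecI) auto

lemma index_mult_mat_sum:
  fixes A B :: "'a::semiring_0 mat"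
  assumes "A \<in> carrier_mat n m" "B \<in> carrier_mat m k" "i < n" "j < k"
  shows "(A * B) $$ (i, j) = (\<Sum>l<m. A $$ (i, l) * B $$ (l, j))"
  using assms by (auto simp: scalar_prod_def lessThan_atLeast0 intro!: sum.cong)

lemma trace_mult_comm:
  fixes A B :: "'a::comm_semiring_0 mat"
  assumes A: "A \<in> carrier_mat n m" and B: "B \<in> carrier_mat m n"
  shows "trace (A * B) = trace (B * A)"
proof -
  have "trace (A * B) = (\<Sum>i<n. \<Sum>l<m. A $$ (i, l) * B $$ (l, i))"
    using A B by (simp add: trace_def index_mult_mat_sum[OF A B] del: index_mult_mat(1))
  also have "\<dots> = (\<Sum>l<m. \<Sum>i<n. B $$ (l, i) * A $$ (i, l))"
    by (subst sum.swap) (simp add: mult.commute)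
  also have "\<dots> = trace (B * A)"
    using A B by (simp add: trace_def index_mult_mat_sum[OF B A] del: index_mult_mat(1))
  finally show ?thesis .
qed

lemma trace_similar:
  fixes A B :: "'a::comm_ring_1 mat"
  assumes "similar_mat A B"
  shows "trace A = trace B"
proof -
  obtain n P Q where c: "{A, B, P, Q} \<subseteq> carrier_mat n n"
    and QP: "Q * P = 1\<^sub>m n" and A: "A = P * B * Q"
    using similar_matD[OF assms] by blast
  have "trace A = trace (Q * (P * B))"
    unfolding A using c by (intro trace_mult_comm[of _ n n]) auto
  also have "Q * (P * B) = (Q * P) * B"
    using c by (intro assoc_mult_mat[symmetric]) auto
  finally show ?thesis
    using c by (simp add: QP left_mult_one_mat[of B n n])
qed

lemma sum_in_Nats:
  "(\<And>x. x \<in> A \<Longrightarrow> f x \<in> \<nat>) \<Longrightarrow> sum f A \<in> \<nat>"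
  by (induction A rule: infinite_finite_induct) auto

text \<open>
  Triangularise the matrix. The diagonal entries of a triangular idempotent are themselves
  idempotent, hence \<open>0\<close> or \<open>1\<close>.
\<close>

lemma trace_idempotent:
  fixes A :: "complex mat"
  assumes A: "A \<in> carrier_mat n n" and idem: "A * A = A"
  shows "trace A \<in> \<nat>"
proof -
  obtain as where "char_poly A = (\<Prod>a\<leftarrow>as. [:- a, 1:])"
    using char_poly_factorized[OF A] by blast
  from schur_decomposition_exists[OF A this]
  obtain B where B: "B \<in> carrier_mat n n" and ut: "upper_triangular B"
    and sim: "similar_mat A B" by blast
  obtain n' P Q where c': "{B, A, P, Q} \<subseteq> carrier_mat n' n'"
    and PQ: "Q * P = 1\<^sub>m n'" and BA': "B = P * A * Q"
    using similar_matD[OF similar_mat_sym[OF sim]] by blast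
  have "n' = n" using c' A by auto
  note c = c'[unfolded this]
  have car: "A * Q \<in> carrier_mat n n" "P * (A * Q) \<in> carrier_mat n n" "A * A \<in> carrier_mat n n"
    using c by auto
  have "B * B = P * (A * ((Q * P) * (A * Q)))"
    unfolding BA' using c car by (simp add: assoc_mult_mat[of _ n n _ n _ n])
  also have "\<dots> = P * (A * (A * Q))"
    unfolding PQ \<open>n' = n\<close> using c car by (simp add: left_mult_one_mat[of _ n n])
  also have "\<dots> = P * ((A * A) * Q)"
    using c car by (simp add: assoc_mult_mat[of _ n n _ n _ n])
  also have "\<dots> = B"
    unfolding BA' idem using c by (simp add: assoc_mult_mat[of _ n n _ n _ n])
  finally have BB: "B * B = B" .
  have "B $$ (i, i) \<in> \<nat>" if i: "i < n" for i
  proof -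
    have "B $$ (i, i) = (\<Sum>l<n. B $$ (i, l) * B $$ (l, i))"
      using index_mult_mat_sum[OF B B i i] by (simp only: BB)
    also have "\<dots> = (\<Sum>l\<in>{i}. B $$ (i, l) * B $$ (l, i))"
    proof (intro sum.mono_neutral_right ballI)
      fix l assume "l \<in> {..<n} - {i}"
      then consider "l < i" "l < n" | "i < l" "l < n" by fastforce
      then show "B $$ (i, l) * B $$ (l, i) = 0"
        using ut B i unfolding upper_triangular_def by cases auto
    qed (use i in auto)
    finally have "B $$ (i, i) = 0 \<or> B $$ (i, i) = 1" by auto
    then show ?thesis by auto
  qed
  then have "trace B \<in> \<nat>"
    unfolding trace_def using B by (intro sum_in_Nats) auto
  then show ?thesis using trace_similar[OF sim] by simp
qed

definition matrix_unit :: "nat \<Rightarrow> nat \<Rightarrow> nat \<Rightarrow> nat \<Rightarrow> complex mat" where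
  "matrix_unit n m i k = mat n m (\<lambda>(a, b). if a = i \<and> b = k then 1 else 0)"

lemma matrix_unit_carrier [simp]: "matrix_unit n m i k \<in> carrier_mat n m"
  by (simp add: matrix_unit_def)

definition mat_sum :: "nat \<Rightarrow> nat \<Rightarrow> ('i \<Rightarrow> 'a::comm_monoid_add mat) \<Rightarrow> 'i set \<Rightarrow> 'a mat" where
  "mat_sum n m F I = mat n m (\<lambda>ij. \<Sum>x\<in>I. F x $$ ij)"

lemma mat_sum_carrier [simp]: "mat_sum n m F I \<in> carrier_mat n m"
  by (simp add: mat_sum_def)

lemma mat_sum_cong:
  assumes "\<And>x. x \<in> I \<Longrightarrow> F x = H x"
  shows "mat_sum n m F I = mat_sum n m H I"
  using assms by (auto simp: mat_sum_def)

lemma mat_sum_reindex: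
  assumes "bij_betw h J I"
  shows "mat_sum n m F I = mat_sum n m (\<lambda>x. F (h x)) J"
  unfolding mat_sum_def by (intro cong_mat refl) (rule sum.reindex_bij_betw[OF assms, symmetric])

lemma mult_mat_sum:
  fixes A :: "'a::semiring_0 mat"
  assumes A: "A \<in> carrier_mat k n" and F: "\<And>x. x \<in> I \<Longrightarrow> F x \<in> carrier_mat n m"
  shows "A * mat_sum n m F I = mat_sum k m (\<lambda>x. A * F x) I"
proof (rule eq_matI)
  fix i j assume "i < dim_row (mat_sum k m (\<lambda>x. A * F x) I)"
    "j < dim_col (mat_sum k m (\<lambda>x. A * F x) I)"
  then have ij: "i < k" "j < m" by (auto simp: mat_sum_def)
  have "(A * mat_sum n m F I) $$ (i, j) = (\<Sum>l<n. A $$ (i, l) * (\<Sum>x\<in>I. F x $$ (l, j)))"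
    unfolding index_mult_mat_sum[OF A mat_sum_carrier ij] using ij by (simp add: mat_sum_def)
  also have "\<dots> = (\<Sum>x\<in>I. \<Sum>l<n. A $$ (i, l) * F x $$ (l, j))"
    unfolding sum_distrib_left by (rule sum.swap)
  also have "\<dots> = (\<Sum>x\<in>I. (A * F x) $$ (i, j))"
    by (intro sum.cong refl index_mult_mat_sum[OF A F ij, symmetric])
  finally show "(A * mat_sum n m F I) $$ (i, j) = mat_sum k m (\<lambda>x. A * F x) I $$ (i, j)"
    using ij by (simp add: mat_sum_def)
qed (use A in \<open>auto simp: mat_sum_def\<close>)

lemma mat_sum_mult:
  fixes A :: "'a::semiring_0 mat"
  assumes A: "A \<in> carrier_mat m k" and F: "\<And>x. x \<in> I \<Longrightarrow> F x \<in> carrier_mat n m"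
  shows "mat_sum n m F I * A = mat_sum n k (\<lambda>x. F x * A) I"
proof (rule eq_matI)
  fix i j assume "i < dim_row (mat_sum n k (\<lambda>x. F x * A) I)"
    "j < dim_col (mat_sum n k (\<lambda>x. F x * A) I)"
  then have ij: "i < n" "j < k" by (auto simp: mat_sum_def)
  have "(mat_sum n m F I * A) $$ (i, j) = (\<Sum>l<m. (\<Sum>x\<in>I. F x $$ (i, l)) * A $$ (l, j))"
    unfolding index_mult_mat_sum[OF mat_sum_carrier A ij] using ij by (simp add: mat_sum_def)
  also have "\<dots> = (\<Sum>x\<in>I. \<Sum>l<m. F x $$ (i, l) * A $$ (l, j))"
    unfolding sum_distrib_right by (rule sum.swap)
  also have "\<dots> = (\<Sum>x\<in>I. (F x * A) $$ (i, j))"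
    by (intro sum.cong refl index_mult_mat_sum[OF F A ij, symmetric])
  finally show "(mat_sum n m F I * A) $$ (i, j) = mat_sum n k (\<lambda>x. F x * A) I $$ (i, j)"
    using ij by (simp add: mat_sum_def)
qed (use A in \<open>auto simp: mat_sum_def\<close>)

lemma trace_mat_sum:
  assumes "\<And>x. x \<in> I \<Longrightarrow> F x \<in> carrier_mat n n"
  shows "trace (mat_sum n n F I) = (\<Sum>x\<in>I. trace (F x))"
proof -
  have "trace (mat_sum n n F I) = (\<Sum>i<n. \<Sum>x\<in>I. F x $$ (i, i))"
    by (simp add: trace_def mat_sum_def)
  also have "\<dots> = (\<Sum>x\<in>I. \<Sum>i<n. F x $$ (i, i))"
    by (rule sum.swap)
  also have "\<dots> = (\<Sum>x\<in>I. trace (F x))"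
    using assms by (intro sum.cong) (auto simp: trace_def)
  finally show ?thesis .
qed

section \<open>Kronecker products\<close>

definition kron :: "'a::times mat \<Rightarrow> 'a mat \<Rightarrow> 'a mat" where
  "kron A B = mat (dim_row A * dim_row B) (dim_col A * dim_col B)
     (\<lambda>(i, j). A $$ (i div dim_row B, j div dim_col B) * B $$ (i mod dim_row B, j mod dim_col B))"

lemma kron_carrier:
  assumes "A \<in> carrier_mat n n'" "B \<in> carrier_mat m m'"
  shows "kron A B \<in> carrier_mat (n * m) (n' * m')"
  using assms by (auto simp: kron_def)

text \<open>
  Rows and columns of a Kronecker product are numbered by \<open>k = i * m + j\<close>; this turns a sum over such
  a number into a double sum over its two digits.
\<close>

lemma sum_div_mod:
  fixes f :: "nat \<Rightarrow> nat \<Rightarrow> 'a::comm_monoid_add"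
  shows "(\<Sum>k<n * m. f (k div m) (k mod m)) = (\<Sum>i<n. \<Sum>j<m. f i j)"
proof -
  have "(\<Sum>i<n. \<Sum>j<m. f i j) = (\<Sum>(i, j)\<in>{..<n} \<times> {..<m}. f i j)"
    by (rule sum.cartesian_product)
  also have "\<dots> = (\<Sum>k<n * m. f (k div m) (k mod m))"
  proof (rule sum.reindex_bij_witness[where i = "\<lambda>k. (k div m, k mod m)" and j = "\<lambda>(i, j). i * m + j"])
    fix k assume "k \<in> {..<n * m}"
    then have "k < n * m" "m > 0" by (auto intro: gr0I)
    then show "(k div m, k mod m) \<in> {..<n} \<times> {..<m}"
      by (auto simp: less_mult_imp_div_less)
  next
    fix a assume "a \<in> {..<n} \<times> {..<m}"
    then obtain i j where a: "a = (i, j)" "i < n" "j < m" by auto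
    have "i * m + j < Suc i * m" using a by simp
    also have "\<dots> \<le> n * m" using a by (intro mult_le_mono1) simp
    finally show "(case a of (i, j) \<Rightarrow> i * m + j) \<in> {..<n * m}" using a by simp
  qed auto
  finally show ?thesis by simp
qed

lemma kron_mult:
  fixes A B C D :: "'a::comm_semiring_0 mat"
  assumes A: "A \<in> carrier_mat n n" and B: "B \<in> carrier_mat m m"
    and C: "C \<in> carrier_mat n n" and D: "D \<in> carrier_mat m m"
  shows "kron A B * kron C D = kron (A * C) (B * D)"
proof (rule eq_matI)
  fix i j assume "i < dim_row (kron (A * C) (B * D))" "j < dim_col (kron (A * C) (B * D))"
  then have ij: "i < n * m" "j < n * m" using assms by (auto simp: kron_def)
  then have m: "m > 0" by (auto intro: gr0I)
  have b: "i div m < n" "j div m < n" "i mod m < m" "j mod m < m"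
    using ij m by (auto simp: less_mult_imp_div_less)
  have "(kron A B * kron C D) $$ (i, j)
      = (\<Sum>k<n * m. (A $$ (i div m, k div m) * B $$ (i mod m, k mod m)) *
                   (C $$ (k div m, j div m) * D $$ (k mod m, j mod m)))"
    unfolding index_mult_mat_sum[OF kron_carrier[OF A B] kron_carrier[OF C D] ij]
    using assms ij by (simp add: kron_def)
  also have "\<dots> = (\<Sum>a<n. \<Sum>b<m. (A $$ (i div m, a) * B $$ (i mod m, b)) *
                   (C $$ (a, j div m) * D $$ (b, j mod m)))"
    by (rule sum_div_mod)
  also have "\<dots> = (\<Sum>a<n. A $$ (i div m, a) * C $$ (a, j div m)) *
                 (\<Sum>b<m. B $$ (i mod m, b) * D $$ (b, j mod m))"
    by (simp add: sum_product mult_ac)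
  also have "\<dots> = (A * C) $$ (i div m, j div m) * (B * D) $$ (i mod m, j mod m)"
    by (simp only: index_mult_mat_sum[OF A C b(1,2)] index_mult_mat_sum[OF B D b(3,4)])
  also have "\<dots> = kron (A * C) (B * D) $$ (i, j)"
    using assms ij by (simp add: kron_def)
  finally show "(kron A B * kron C D) $$ (i, j) = kron (A * C) (B * D) $$ (i, j)" .
qed (use assms in \<open>auto simp: kron_def\<close>)

lemma kron_one: "kron (1\<^sub>m n) (1\<^sub>m m) = (1\<^sub>m (n * m) :: 'a::semiring_1 mat)"
proof (rule eq_matI)
  fix i j assume ij: "i < dim_row (1\<^sub>m (n * m) :: 'a mat)" "j < dim_col (1\<^sub>m (n * m) :: 'a mat)"
  then have "m > 0" by (auto intro: gr0I)
  moreover have "i = j" if "i div m = j div m" "i mod m = j mod m"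
    using that by (metis div_mult_mod_eq)
  ultimately show "kron (1\<^sub>m n) (1\<^sub>m m) $$ (i, j) = (1\<^sub>m (n * m) :: 'a mat) $$ (i, j)"
    using ij by (auto simp: kron_def less_mult_imp_div_less)
qed (auto simp: kron_def)

lemma trace_kron:
  fixes A B :: "'a::comm_semiring_0 mat"
  assumes "A \<in> carrier_mat n n" "B \<in> carrier_mat m m"
  shows "trace (kron A B) = trace A * trace B"
proof -
  have "trace (kron A B) = (\<Sum>k<n * m. A $$ (k div m, k div m) * B $$ (k mod m, k mod m))"
    using assms by (simp add: trace_def kron_def)
  also have "\<dots> = (\<Sum>i<n. \<Sum>j<m. A $$ (i, i) * B $$ (j, j))"
    by (rule sum_div_mod)
  also have "\<dots> = trace A * trace B"
    using assms by (simp add: trace_def sum_product)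
  finally show ?thesis .
qed

section \<open>Representations, tensor products and duals\<close>

context group
begin

text \<open>
  The value at \<open>\<one>\<close> stands for membership in the general linear group: it makes \<open>\<rho> (inv g)\<close> an inverse
  of \<open>\<rho> g\<close>.
\<close>

lemma is_rep_iff:
  "is_rep G n \<rho> \<longleftrightarrow>
     (\<forall>g\<in>carrier G. \<rho> g \<in> carrier_mat n n) \<and>
     (\<forall>g\<in>carrier G. \<forall>h\<in>carrier G. \<rho> (g \<otimes> h) = \<rho> g * \<rho> h) \<and> \<rho> \<one> = 1\<^sub>m n"
proof
  assume r: "is_rep G n \<rho>"
  interpret M: ring "ring_mat TYPE(complex) n ()" by (rule ring_mat)
  have gl: "group (general_linear n)"
    unfolding general_linear_def by (rule M.units_group)
  have h: "\<rho> \<in> hom G (general_linear n)" using r by (simp add: is_rep_def)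
  have one: "\<rho> \<one> = 1\<^sub>m n"
    using hom_one[OF h is_group gl]
    by (simp add: general_linear_def units_of_def ring_mat_def)
  have "\<rho> g \<in> carrier_mat n n" if "g \<in> carrier G" for g
    using hom_in_carrier[OF h that]
    by (auto simp: general_linear_def units_of_def Units_def ring_mat_def)
  moreover have "\<rho> (g \<otimes> k) = \<rho> g * \<rho> k" if "g \<in> carrier G" "k \<in> carrier G" for g k
    using hom_mult[OF h that] by (simp add: general_linear_def units_of_def ring_mat_def)
  ultimately show "(\<forall>g\<in>carrier G. \<rho> g \<in> carrier_mat n n) \<and>
     (\<forall>g\<in>carrier G. \<forall>h\<in>carrier G. \<rho> (g \<otimes> h) = \<rho> g * \<rho> h) \<and> \<rho> \<one> = 1\<^sub>m n"
    using one by blast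
next
  assume a: "(\<forall>g\<in>carrier G. \<rho> g \<in> carrier_mat n n) \<and>
     (\<forall>g\<in>carrier G. \<forall>h\<in>carrier G. \<rho> (g \<otimes> h) = \<rho> g * \<rho> h) \<and> \<rho> \<one> = 1\<^sub>m n"
  have "\<rho> g \<in> Units (ring_mat TYPE(complex) n ())" if g: "g \<in> carrier G" for g
  proof -
    have "\<rho> g * \<rho> (inv g) = 1\<^sub>m n" "\<rho> (inv g) * \<rho> g = 1\<^sub>m n"
      using a g by (metis inv_closed r_inv, metis inv_closed l_inv)
    then show ?thesis
      using a g by (auto simp: Units_def ring_mat_def intro!: bexI[of _ "\<rho> (inv g)"])
  qed
  then show "is_rep G n \<rho>"
    using a by (auto simp: is_rep_def hom_def general_linear_def units_of_def ring_mat_def)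
qed

lemma is_rep_carrier: "is_rep G n \<rho> \<Longrightarrow> g \<in> carrier G \<Longrightarrow> \<rho> g \<in> carrier_mat n n"
  by (simp add: is_rep_iff)

lemma is_rep_mult:
  "is_rep G n \<rho> \<Longrightarrow> g \<in> carrier G \<Longrightarrow> h \<in> carrier G \<Longrightarrow> \<rho> (g \<otimes> h) = \<rho> g * \<rho> h"
  by (simp add: is_rep_iff)

lemma is_rep_inv_right: "is_rep G n \<rho> \<Longrightarrow> g \<in> carrier G \<Longrightarrow> \<rho> g * \<rho> (inv g) = 1\<^sub>m n"
  by (metis is_rep_iff inv_closed r_inv)

lemma is_rep_tensor:
  assumes "is_rep G n \<rho>" "is_rep G m \<tau>"
  shows "is_rep G (n * m) (\<lambda>g. kron (\<rho> g) (\<tau> g))"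
  using assms by (auto simp: is_rep_iff kron_one kron_mult[of _ n _ m] intro!: kron_carrier)

lemma is_rep_dual:
  assumes "is_rep G n \<rho>"
  shows "is_rep G n (\<lambda>g. transpose_mat (\<rho> (inv g)))"
  using assms by (auto simp: is_rep_iff inv_mult_group intro!: transpose_mult[of _ n n _ n])

lemma rep_char_tensor:
  assumes "is_rep G n \<rho>" "is_rep G m \<tau>" "g \<in> carrier G"
  shows "rep_char (\<lambda>g. kron (\<rho> g) (\<tau> g)) g = rep_char \<rho> g * rep_char \<tau> g"
  unfolding rep_char_eq_trace using assms by (intro trace_kron is_rep_carrier)

lemma rep_char_dual:
  assumes "is_rep G n \<rho>" "g \<in> carrier G"
  shows "rep_char (\<lambda>g. transpose_mat (\<rho> (inv g))) g = rep_char \<rho> (inv g)"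
  using is_rep_carrier[OF assms(1) inv_closed[OF assms(2)]] by (simp add: rep_char_def)

lemma bij_betw_left_mult: "h \<in> carrier G \<Longrightarrow> bij_betw ((\<otimes>) h) (carrier G) (carrier G)"
  by (rule bij_betwI[where g = "(\<otimes>) (inv h)"]) (auto simp: m_assoc[symmetric])

text \<open>
  The number \<open>k\<close> is the dimension of the space of \<open>G\<close>-invariant vectors. With \<open>E = (\<Sum>g. \<rho> g)\<close>,
  translation invariance of the sum gives \<open>\<rho> h * E = E\<close>, hence \<open>E * E = |G| E\<close>, so that \<open>E / |G|\<close> is
  idempotent and its trace is natural.
\<close>

lemma sum_rep_char:
  assumes fin: "finite (carrier G)" and r: "is_rep G n \<rho>"
  shows "\<exists>k. (\<Sum>g\<in>carrier G. rep_char \<rho> g) = of_nat (card (carrier G)) * of_nat k"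
proof -
  define c where "c = (of_nat (card (carrier G)) :: complex)"
  have c0: "c \<noteq> 0" using fin by (auto simp: c_def card_eq_0_iff)
  define E where "E = mat_sum n n \<rho> (carrier G)"
  have E: "E \<in> carrier_mat n n" by (simp add: E_def)
  note car = is_rep_carrier[OF r]
  have inv: "\<rho> h * E = E" if h: "h \<in> carrier G" for h
  proof -
    have "\<rho> h * E = mat_sum n n (\<lambda>g. \<rho> h * \<rho> g) (carrier G)"
      unfolding E_def using car h by (intro mult_mat_sum)
    also have "\<dots> = mat_sum n n (\<lambda>g. \<rho> (h \<otimes> g)) (carrier G)"
      using r h by (intro mat_sum_cong) (simp add: is_rep_mult)
    also have "\<dots> = E"
      unfolding E_def using bij_betw_left_mult[OF h] by (rule mat_sum_reindex[symmetric])
    finally show ?thesis .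
  qed
  have "E * E = mat_sum n n (\<lambda>h. \<rho> h * E) (carrier G)"
    by (subst (1) E_def) (intro mat_sum_mult E car)
  also have "\<dots> = mat_sum n n (\<lambda>h. E) (carrier G)"
    by (intro mat_sum_cong inv)
  also have "\<dots> = c \<cdot>\<^sub>m E"
    using E by (intro eq_matI) (auto simp: mat_sum_def c_def)
  finally have EE: "E * E = c \<cdot>\<^sub>m E" .
  define A where "A = inverse c \<cdot>\<^sub>m E"
  have A: "A \<in> carrier_mat n n" using E by (simp add: A_def)
  have "A * A = inverse c \<cdot>\<^sub>m (inverse c \<cdot>\<^sub>m (E * E))"
    unfolding A_def using E by (simp add: mult_smult_distrib[of _ n n _ n] mult_smult_assoc_mat[of _ n n _ n])
  also have "\<dots> = A"
    unfolding EE A_def using E c0 by (intro eq_matI) auto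
  finally have "trace A \<in> \<nat>" using A by (intro trace_idempotent)
  then obtain k where k: "trace A = of_nat k" by (auto simp: Nats_def)
  have "(\<Sum>g\<in>carrier G. rep_char \<rho> g) = trace E"
    unfolding rep_char_eq_trace E_def using car by (rule trace_mat_sum[symmetric])
  also have "\<dots> = c * trace A"
    using E c0 by (simp add: A_def trace_def sum_distrib_left mult.assoc[symmetric])
  finally show ?thesis using k by (auto simp: c_def)
qed

text \<open>
  This says that the multiplicity of \<open>s\<close> in \<open>a \<otimes> b\<close> is a natural number; here it is obtained as the
  dimension of the invariants of \<open>a \<otimes> b \<otimes> s*\<close>.
\<close>

lemma sum_char_triple:
  assumes fin: "finite (carrier G)" and a: "is_rep G na a" and b: "is_rep G nb b"
    and s: "is_rep G ns s"
  shows "\<exists>k. (\<Sum>g\<in>carrier G. rep_char a g * rep_char b g * rep_char s (inv g))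
             = of_nat (card (carrier G)) * of_nat k"
proof -
  let ?s = "\<lambda>g. transpose_mat (s (inv g))"
  let ?ab = "\<lambda>g. kron (a g) (b g)"
  note ab = is_rep_tensor[OF a b] and s' = is_rep_dual[OF s]
  have "(\<Sum>g\<in>carrier G. rep_char a g * rep_char b g * rep_char s (inv g))
      = (\<Sum>g\<in>carrier G. rep_char (\<lambda>g. kron (?ab g) (?s g)) g)"
    by (intro sum.cong refl)
      (simp add: rep_char_tensor[OF ab s'] rep_char_tensor[OF a b] rep_char_dual[OF s])
  then show ?thesis
    using sum_rep_char[OF fin is_rep_tensor[OF ab s']] by simp
qed

section \<open>Schur's lemma and orthogonality of characters\<close>


lemma is_rep_dim_unique:
  assumes "is_rep G n \<rho>" "is_rep G m \<rho>"
  shows "n = m"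
  using is_rep_carrier[OF assms(1) one_closed] is_rep_carrier[OF assms(2) one_closed] by auto

lemma is_irrep_dim_pos: "is_irrep G \<rho> \<Longrightarrow> is_rep G n \<rho> \<Longrightarrow> n > 0"
  unfolding is_irrep_def by (elim exE conjE) (drule (1) is_rep_dim_unique, simp)

lemma is_irrep_is_rep: "is_irrep G \<rho> \<Longrightarrow> \<exists>n. is_rep G n \<rho>"
  unfolding is_irrep_def by (elim exE conjE) (rule exI)

lemma is_irrep_invariant:
  assumes irr: "is_irrep G \<rho>" and r: "is_rep G n \<rho>"
    and W: "W \<subseteq> carrier_vec n" "0\<^sub>v n \<in> W"
      "\<And>v w. v \<in> W \<Longrightarrow> w \<in> W \<Longrightarrow> v + w \<in> W" "\<And>c v. v \<in> W \<Longrightarrow> c \<cdot>\<^sub>v v \<in> W"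
    and inv: "\<And>g w. g \<in> carrier G \<Longrightarrow> w \<in> W \<Longrightarrow> \<rho> g *\<^sub>v w \<in> W"
  shows "W = {0\<^sub>v n} \<or> W = carrier_vec n"
proof -
  have "submodule class_ring W (module_vec TYPE(complex) n)"
    using W by (intro submodule.intro vec_module) (auto simp: module_vec_simps)
  then have "VectorSpace.subspace class_ring W (module_vec TYPE(complex) n)"
    by (intro subspace.intro vec_vs)
  moreover obtain n' where n': "is_rep G n' \<rho>"
    and "\<forall>W. VectorSpace.subspace class_ring W (module_vec TYPE(complex) n') \<and>
          (\<forall>g\<in>carrier G. \<forall>w\<in>W. \<rho> g *\<^sub>v w \<in> W) \<longrightarrow> W = {0\<^sub>v n'} \<or> W = carrier_vec n'"
    using irr unfolding is_irrep_def by (elim exE conjE)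
  moreover have "n' = n" using n' r by (rule is_rep_dim_unique)
  ultimately show ?thesis using inv by simp
qed

definition intertwines :: "('a \<Rightarrow> complex mat) \<Rightarrow> ('a \<Rightarrow> complex mat) \<Rightarrow> complex mat \<Rightarrow> bool" where
  "intertwines \<rho> \<tau> T \<longleftrightarrow> (\<forall>g\<in>carrier G. \<rho> g * T = T * \<tau> g)"

text \<open>
  Kernel and range of an intertwining matrix are invariant subspaces, so each of them is zero or
  everything. Unless \<open>T\<close> vanishes, it is therefore injective and surjective; a right inverse is
  assembled from preimages of the unit vectors, and injectivity makes it a left inverse.
\<close>

lemma schur_dichotomy:
  assumes \<rho>: "is_irrep G \<rho>" "is_rep G n \<rho>" and \<tau>: "is_irrep G \<tau>" "is_rep G m \<tau>"
    and T: "T \<in> carrier_mat n m" and inter: "intertwines \<rho> \<tau> T"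
  shows "T = 0\<^sub>m n m \<or> (\<exists>P\<in>carrier_mat m n. T * P = 1\<^sub>m n \<and> P * T = 1\<^sub>m m)"
proof (cases "T = 0\<^sub>m n m")
  case False
  have zero: "T = 0\<^sub>m n m" if "\<And>v. v \<in> carrier_vec m \<Longrightarrow> T *\<^sub>v v = 0\<^sub>v n"
    using that T by (intro mat_eq_on_vecI) auto
  have move: "\<rho> g *\<^sub>v (T *\<^sub>v v) = T *\<^sub>v (\<tau> g *\<^sub>v v)" if "g \<in> carrier G" "v \<in> carrier_vec m" for g v
  proof -
    have "\<rho> g *\<^sub>v (T *\<^sub>v v) = (\<rho> g * T) *\<^sub>v v"
      using is_rep_carrier[OF \<rho>(2) that(1)] T that(2) by (rule assoc_mult_mat_vec[symmetric])
    also have "\<dots> = (T * \<tau> g) *\<^sub>v v"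
      using inter that(1) by (simp add: intertwines_def)
    also have "\<dots> = T *\<^sub>v (\<tau> g *\<^sub>v v)"
      using T is_rep_carrier[OF \<tau>(2) that(1)] that(2) by (rule assoc_mult_mat_vec)
    finally show ?thesis .
  qed
  define K where "K = {v \<in> carrier_vec m. T *\<^sub>v v = 0\<^sub>v n}"
  define J where "J = (\<lambda>v. T *\<^sub>v v) ` carrier_vec m"
  have "K = {0\<^sub>v m} \<or> K = carrier_vec m"
  proof (rule is_irrep_invariant[OF \<tau>])
    fix g w assume "g \<in> carrier G" "w \<in> K"
    then show "\<tau> g *\<^sub>v w \<in> K"
      using move[of g w] is_rep_carrier[OF \<rho>(2), of g] is_rep_carrier[OF \<tau>(2), of g]
      by (auto simp: K_def mult_mat_zero_vec)
  qed (use T in \<open>auto simp: K_def mult_add_distrib_mat_vec[OF T] mult_mat_vec[OF T]\<close>)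
  moreover have "K \<noteq> carrier_vec m" using zero False by (auto simp: K_def)
  ultimately have K: "K = {0\<^sub>v m}" by blast
  have "J = {0\<^sub>v n} \<or> J = carrier_vec n"
  proof (rule is_irrep_invariant[OF \<rho>])
    fix g w assume "g \<in> carrier G" "w \<in> J"
    then show "\<rho> g *\<^sub>v w \<in> J"
      using move[of g] is_rep_carrier[OF \<tau>(2), of g] by (auto simp: J_def)
  next
    show "0\<^sub>v n \<in> J"
      unfolding J_def by (rule image_eqI[of _ _ "0\<^sub>v m"]) (use T in auto)
  next
    fix v w assume "v \<in> J" "w \<in> J"
    then show "v + w \<in> J"
      by (auto simp: J_def mult_add_distrib_mat_vec[OF T, symmetric])
  next
    fix c v assume "v \<in> J"
    then show "c \<cdot>\<^sub>v v \<in> J"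
      by (auto simp: J_def mult_mat_vec[OF T, symmetric])
  qed (use T in \<open>auto simp: J_def\<close>)
  moreover have "J \<noteq> {0\<^sub>v n}" using zero False by (auto simp: J_def)
  ultimately have J: "J = carrier_vec n" by blast
  have "\<exists>v. v \<in> carrier_vec m \<and> T *\<^sub>v v = unit_vec n i" for i
  proof -
    have "unit_vec n i \<in> J" unfolding J by simp
    then show ?thesis unfolding J_def by auto
  qed
  then obtain w where "\<forall>i. w i \<in> carrier_vec m \<and> T *\<^sub>v w i = unit_vec n i"
    using choice[of "\<lambda>i v. v \<in> carrier_vec m \<and> T *\<^sub>v v = unit_vec n i"] by blast
  then have w: "\<And>i. w i \<in> carrier_vec m" "\<And>i. T *\<^sub>v w i = unit_vec n i" by auto
  define P where "P = mat m n (\<lambda>(j, i). w i $ j)"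
  have P: "P \<in> carrier_mat m n" by (simp add: P_def)
  have colP: "col P i = w i" if "i < n" for i
    using that w(1)[of i] by (auto simp: P_def)
  have TP: "T * P = 1\<^sub>m n"
  proof (rule eq_matI)
    fix i j assume ij: "i < dim_row (1\<^sub>m n :: complex mat)" "j < dim_col (1\<^sub>m n :: complex mat)"
    then have "(T * P) $$ (i, j) = (T *\<^sub>v w j) $ i"
      using T P colP by simp
    then show "(T * P) $$ (i, j) = 1\<^sub>m n $$ (i, j)"
      using ij by (simp add: w(2))
  qed (use T P in auto)
  have "P * T = 1\<^sub>m m"
  proof (rule mat_eq_on_vecI)
    fix v assume v: "v \<in> (carrier_vec m :: complex vec set)"
    have Tv: "T *\<^sub>v v \<in> carrier_vec n" and PTv: "P *\<^sub>v (T *\<^sub>v v) \<in> carrier_vec m"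
      using T P v by auto
    have "T *\<^sub>v (P *\<^sub>v (T *\<^sub>v v)) = (T * P) *\<^sub>v (T *\<^sub>v v)"
      using T P Tv by simp
    then have "T *\<^sub>v (P *\<^sub>v (T *\<^sub>v v) - v) = 0\<^sub>v n"
      using Tv mult_minus_distrib_mat_vec[OF T PTv v] by (simp add: TP)
    then have "P *\<^sub>v (T *\<^sub>v v) - v \<in> K" using PTv v by (auto simp: K_def)
    then have z: "P *\<^sub>v (T *\<^sub>v v) - v = 0\<^sub>v m" by (simp add: K)
    have "P *\<^sub>v (T *\<^sub>v v) = v"
    proof (rule eq_vecI)
      fix i assume "i < dim_vec v"
      then show "(P *\<^sub>v (T *\<^sub>v v)) $ i = v $ i"
        using arg_cong[OF z, of "\<lambda>u. u $ i"] v by auto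
    qed (use P PTv v in auto)
    then show "P * T *\<^sub>v v = 1\<^sub>m m *\<^sub>v v"
      using T P v by simp
  qed (use T P in auto)
  with TP have "\<exists>P\<in>carrier_mat m n. T * P = 1\<^sub>m n \<and> P * T = 1\<^sub>m m"
    by (intro bexI[OF _ P] conjI)
  then show ?thesis by (rule disjI2)
qed (rule disjI1)

text \<open>
  An invertible intertwining matrix would be an isomorphism. It is square because \<open>T * P\<close> and \<open>P * T\<close>
  are identity matrices with the same trace.
\<close>

lemma schur_zero:
  assumes \<rho>: "is_irrep G \<rho>" "is_rep G n \<rho>" and \<tau>: "is_irrep G \<tau>" "is_rep G m \<tau>"
    and T: "T \<in> carrier_mat n m" and inter: "intertwines \<rho> \<tau> T" and "\<not> rep_iso G \<rho> \<tau>"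
  shows "T = 0\<^sub>m n m"
proof (rule ccontr)
  assume "T \<noteq> 0\<^sub>m n m"
  then obtain P where P: "P \<in> carrier_mat m n" and TP: "T * P = 1\<^sub>m n" and PT: "P * T = 1\<^sub>m m"
    using schur_dichotomy[OF \<rho> \<tau> T inter] by blast
  have "of_nat n = (of_nat m :: complex)"
    using trace_mult_comm[OF T P] by (simp add: TP PT trace_def)
  then have nm: "m = n" by simp
  have "similar_mat_wit (\<rho> g) (\<tau> g) T P" if g: "g \<in> carrier G" for g
  proof (rule similar_mat_witI)
    have r: "\<rho> g \<in> carrier_mat n n" using \<rho>(2) g by (rule is_rep_carrier)
    have "T * \<tau> g * P = \<rho> g * T * P" using inter g by (simp add: intertwines_def)
    also have "\<dots> = \<rho> g * (T * P)" using r T P by (rule assoc_mult_mat)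
    finally show "\<rho> g = T * \<tau> g * P" using r by (simp add: TP)
  qed (use T P TP PT nm is_rep_carrier[OF \<rho>(2) g] is_rep_carrier[OF \<tau>(2) g] in auto)
  then have "rep_iso G \<rho> \<tau>" unfolding rep_iso_def by blast
  then show False using assms by simp
qed

text \<open>
  Subtracting an eigenvalue leaves an intertwining matrix that is not invertible, hence zero.
\<close>

lemma schur_scalar:
  assumes \<rho>: "is_irrep G \<rho>" "is_rep G n \<rho>"
    and T: "T \<in> carrier_mat n n" and inter: "intertwines \<rho> \<rho> T"
  shows "\<exists>c. T = c \<cdot>\<^sub>m 1\<^sub>m n"
proof -
  obtain c v where ev: "eigenvector T v c"
    using spectrum_non_empty[OF T is_irrep_dim_pos[OF \<rho>]]
    by (auto simp: spectrum_def eigenvalue_def)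
  define S where "S = T - c \<cdot>\<^sub>m 1\<^sub>m n"
  have S: "S \<in> carrier_mat n n" unfolding S_def by (intro minus_carrier_mat) simp
  have v: "v \<in> carrier_vec n" "v \<noteq> 0\<^sub>v n" "T *\<^sub>v v = c \<cdot>\<^sub>v v"
    using ev T by (auto simp: eigenvector_def)
  have Sv: "S *\<^sub>v v = 0\<^sub>v n"
    unfolding S_def using T v by (subst minus_mult_distrib_mat_vec[of _ n n]) (auto simp: smult_one_mat_mult_vec)
  have "intertwines \<rho> \<rho> S"
    unfolding intertwines_def
  proof
    fix g assume g: "g \<in> carrier G"
    have r: "\<rho> g \<in> carrier_mat n n" using \<rho>(2) g by (rule is_rep_carrier)
    have "\<rho> g * T = T * \<rho> g" using inter g by (simp add: intertwines_def)
    then show "\<rho> g * S = S * \<rho> g"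
      unfolding S_def using r T
      by (simp add: mult_minus_distrib_mat[of _ n n] minus_mult_distrib_mat[of _ n n]
          mult_smult_distrib[of _ n n _ n] mult_smult_assoc_mat[of _ n n _ n])
  qed
  from schur_dichotomy[OF \<rho> \<rho> S this]
  have S0: "S = 0\<^sub>m n n"
  proof
    assume "\<exists>P\<in>carrier_mat n n. S * P = 1\<^sub>m n \<and> P * S = 1\<^sub>m n"
    then obtain P where P: "P \<in> carrier_mat n n" "P * S = 1\<^sub>m n" by blast
    have "v = P * S *\<^sub>v v" using P v by simp
    also have "\<dots> = P *\<^sub>v (S *\<^sub>v v)" using P(1) S v(1) by (rule assoc_mult_mat_vec)
    also have "\<dots> = 0\<^sub>v n" using P by (simp add: Sv mult_mat_zero_vec)
    finally show ?thesis using v by simp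
  qed
  have "T = c \<cdot>\<^sub>m 1\<^sub>m n"
  proof (rule eq_matI)
    fix i j assume "i < dim_row (c \<cdot>\<^sub>m 1\<^sub>m n)" "j < dim_col (c \<cdot>\<^sub>m 1\<^sub>m n)"
    then show "T $$ (i, j) = (c \<cdot>\<^sub>m 1\<^sub>m n) $$ (i, j)"
      using arg_cong[OF S0, of "\<lambda>M. M $$ (i, j)"] T by (simp add: S_def)
  qed (use T in auto)
  then show ?thesis ..
qed

text \<open>
  Averaging an arbitrary matrix \<open>X\<close> over the group, up to the factor \<open>1 / |G|\<close>, is the standard source
  of intertwining matrices.
\<close>

definition twirl :: "nat \<Rightarrow> nat \<Rightarrow> ('a \<Rightarrow> complex mat) \<Rightarrow> ('a \<Rightarrow> complex mat) \<Rightarrow> complex mat \<Rightarrow> complex mat" where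
  "twirl n m \<rho> \<tau> X = mat_sum n m (\<lambda>g. \<rho> g * X * \<tau> (inv g)) (carrier G)"

lemma twirl_carrier [simp]: "twirl n m \<rho> \<tau> X \<in> carrier_mat n m"
  by (simp add: twirl_def)

lemma intertwines_twirl:
  assumes \<rho>: "is_rep G n \<rho>" and \<tau>: "is_rep G m \<tau>" and X: "X \<in> carrier_mat n m"
  shows "intertwines \<rho> \<tau> (twirl n m \<rho> \<tau> X)"
  unfolding intertwines_def
proof
  fix h assume h: "h \<in> carrier G"
  note r = is_rep_carrier[OF \<rho>] and t = is_rep_carrier[OF \<tau>]
  have car: "\<rho> g * X * \<tau> (inv g) \<in> carrier_mat n m" if "g \<in> carrier G" for g
    using r[OF that] t[of "inv g"] X that by auto
  have "\<rho> h * twirl n m \<rho> \<tau> X = mat_sum n m (\<lambda>g. \<rho> h * (\<rho> g * X * \<tau> (inv g))) (carrier G)"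
    unfolding twirl_def using r[OF h] car by (rule mult_mat_sum)
  also have "\<dots> = mat_sum n m (\<lambda>g. \<rho> (h \<otimes> g) * X * \<tau> (inv (h \<otimes> g)) * \<tau> h) (carrier G)"
  proof (rule mat_sum_cong)
    fix g assume g: "g \<in> carrier G"
    have "\<tau> (inv g) = \<tau> (inv (h \<otimes> g)) * \<tau> h"
      using g h by (simp add: is_rep_mult[OF \<tau>, symmetric] inv_mult_group m_assoc)
    then show "\<rho> h * (\<rho> g * X * \<tau> (inv g)) = \<rho> (h \<otimes> g) * X * \<tau> (inv (h \<otimes> g)) * \<tau> h"
      using r[OF h] r[OF g] t[OF h] t[of "inv (h \<otimes> g)"] X g h
      by (simp add: is_rep_mult[OF \<rho>] assoc_mult_mat[of _ n n _ n _ m] assoc_mult_mat[of _ n n _ m _ m]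
          assoc_mult_mat[of _ n m _ m _ m])
  qed
  also have "\<dots> = mat_sum n m (\<lambda>g. \<rho> g * X * \<tau> (inv g) * \<tau> h) (carrier G)"
    using bij_betw_left_mult[OF h] by (rule mat_sum_reindex[symmetric])
  also have "\<dots> = twirl n m \<rho> \<tau> X * \<tau> h"
    unfolding twirl_def using t[OF h] car by (rule mat_sum_mult[symmetric])
  finally show "\<rho> h * twirl n m \<rho> \<tau> X = twirl n m \<rho> \<tau> X * \<tau> h" .
qed

lemma trace_twirl:
  assumes \<rho>: "is_rep G n \<rho>" and X: "X \<in> carrier_mat n n"
  shows "trace (twirl n n \<rho> \<rho> X) = of_nat (card (carrier G)) * trace X"
proof -
  have "trace (twirl n n \<rho> \<rho> X) = (\<Sum>g\<in>carrier G. trace (\<rho> g * X * \<rho> (inv g)))"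
    unfolding twirl_def
  proof (rule trace_mat_sum)
    fix g assume "g \<in> carrier G"
    then show "\<rho> g * X * \<rho> (inv g) \<in> carrier_mat n n"
      using is_rep_carrier[OF \<rho>, of g] is_rep_carrier[OF \<rho>, of "inv g"] X by auto
  qed
  also have "\<dots> = (\<Sum>g\<in>carrier G. trace X)"
  proof (rule sum.cong[OF refl])
    fix g assume g: "g \<in> carrier G"
    then show "trace (\<rho> g * X * \<rho> (inv g)) = trace X"
      using is_rep_carrier[OF \<rho>, of g] is_rep_carrier[OF \<rho>, of "inv g"] X is_rep_inv_right[OF \<rho> g]
        is_rep_inv_right[OF \<rho>, of "inv g"]
      by (intro trace_similar similar_matI[of _ _ "\<rho> g" "\<rho> (inv g)" n]) auto
  qed
  finally show ?thesis by simp
qed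

text \<open>
  The entry \<open>(i, k)\<close> of \<open>\<rho> g * E\<^sub>i\<^sub>k * \<tau> (inv g)\<close> is the product of the diagonal entries \<open>\<rho> g $$ (i, i)\<close> and
  \<open>\<tau> (inv g) $$ (k, k)\<close>, so a product of characters is a sum of such entries. This is how Schur's lemma
  is applied to characters.
\<close>

lemma sum_char_product:
  assumes \<rho>: "is_rep G n \<rho>" and \<tau>: "is_rep G m \<tau>"
  shows "(\<Sum>g\<in>carrier G. rep_char \<rho> g * rep_char \<tau> (inv g))
       = (\<Sum>i<n. \<Sum>k<m. twirl n m \<rho> \<tau> (matrix_unit n m i k) $$ (i, k))"
proof -
  have entry: "(\<rho> g * matrix_unit n m i k * \<tau> (inv g)) $$ (i, k) = \<rho> g $$ (i, i) * \<tau> (inv g) $$ (k, k)"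
    if g: "g \<in> carrier G" and i: "i < n" and k: "k < m" for g i k
  proof -
    have r: "\<rho> g \<in> carrier_mat n n" and t: "\<tau> (inv g) \<in> carrier_mat m m"
      using g is_rep_carrier[OF \<rho>] is_rep_carrier[OF \<tau>] by auto
    have ru: "\<rho> g * matrix_unit n m i k \<in> carrier_mat n m"
      using r by (rule mult_carrier_mat) simp
    have "(\<rho> g * matrix_unit n m i k) $$ (i, l) = (if l = k then \<rho> g $$ (i, i) else 0)" if "l < m" for l
    proof -
      have "(\<rho> g * matrix_unit n m i k) $$ (i, l) = (\<Sum>a<n. \<rho> g $$ (i, a) * (if a = i \<and> l = k then 1 else 0))"
        unfolding index_mult_mat_sum[OF r matrix_unit_carrier i that] using that
        by (intro sum.cong) (auto simp: matrix_unit_def)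
      also have "\<dots> = (\<Sum>a<n. if a = i then (if l = k then \<rho> g $$ (i, i) else 0) else 0)"
        by (intro sum.cong) auto
      finally show ?thesis using i by simp
    qed
    then have "(\<rho> g * matrix_unit n m i k * \<tau> (inv g)) $$ (i, k)
        = (\<Sum>l<m. if l = k then \<rho> g $$ (i, i) * \<tau> (inv g) $$ (k, k) else 0)"
      unfolding index_mult_mat_sum[OF ru t i k] by (intro sum.cong) auto
    then show ?thesis using k by simp
  qed
  have "(\<Sum>g\<in>carrier G. rep_char \<rho> g * rep_char \<tau> (inv g))
      = (\<Sum>g\<in>carrier G. \<Sum>i<n. \<Sum>k<m. \<rho> g $$ (i, i) * \<tau> (inv g) $$ (k, k))"
  proof (rule sum.cong[OF refl])
    fix g assume "g \<in> carrier G"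
    then show "rep_char \<rho> g * rep_char \<tau> (inv g) = (\<Sum>i<n. \<Sum>k<m. \<rho> g $$ (i, i) * \<tau> (inv g) $$ (k, k))"
      using is_rep_carrier[OF \<rho>, of g] is_rep_carrier[OF \<tau>, of "inv g"]
      by (simp add: rep_char_def sum_product)
  qed
  also have "\<dots> = (\<Sum>i<n. \<Sum>g\<in>carrier G. \<Sum>k<m. \<rho> g $$ (i, i) * \<tau> (inv g) $$ (k, k))"
    by (rule sum.swap)
  also have "\<dots> = (\<Sum>i<n. \<Sum>k<m. \<Sum>g\<in>carrier G. \<rho> g $$ (i, i) * \<tau> (inv g) $$ (k, k))"
    by (rule sum.cong[OF refl], rule sum.swap)
  also have "\<dots> = (\<Sum>i<n. \<Sum>k<m. twirl n m \<rho> \<tau> (matrix_unit n m i k) $$ (i, k))"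
    by (intro sum.cong refl) (simp add: twirl_def mat_sum_def entry del: index_mult_mat(1))
  finally show ?thesis .
qed

lemma char_orthogonal:
  assumes \<rho>: "is_irrep G \<rho>" and \<tau>: "is_irrep G \<tau>" and niso: "\<not> rep_iso G \<rho> \<tau>"
  shows "(\<Sum>g\<in>carrier G. rep_char \<rho> g * rep_char \<tau> (inv g)) = 0"
proof -
  obtain n m where n: "is_rep G n \<rho>" and m: "is_rep G m \<tau>"
    using is_irrep_is_rep[OF \<rho>] is_irrep_is_rep[OF \<tau>] by blast
  have "twirl n m \<rho> \<tau> X = 0\<^sub>m n m" if "X \<in> carrier_mat n m" for X
    using \<rho> n \<tau> m twirl_carrier intertwines_twirl[OF n m that] niso by (rule schur_zero)
  then show ?thesis
    unfolding sum_char_product[OF n m] by simp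
qed

text \<open>
  By Schur's lemma the twirled matrix unit \<open>E\<^sub>i\<^sub>k\<close> is a scalar matrix. Its trace \<open>|G| tr E\<^sub>i\<^sub>k\<close> shows that the
  scalar is \<open>|G| / n\<close> for \<open>i = k\<close>; the off-diagonal pairs contribute nothing.
\<close>

lemma char_norm:
  assumes \<rho>: "is_irrep G \<rho>"
  shows "(\<Sum>g\<in>carrier G. rep_char \<rho> g * rep_char \<rho> (inv g)) = of_nat (card (carrier G))"
proof -
  let ?c = "of_nat (card (carrier G)) :: complex"
  obtain n where n: "is_rep G n \<rho>"
    using is_irrep_is_rep[OF \<rho>] by blast
  have n0: "n > 0" using is_irrep_dim_pos[OF \<rho> n] .
  have "twirl n n \<rho> \<rho> (matrix_unit n n i k) $$ (i, k) = (if i = k then ?c / of_nat n else 0)"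
    if ik: "i < n" "k < n" for i k
  proof -
    obtain c where c: "twirl n n \<rho> \<rho> (matrix_unit n n i k) = c \<cdot>\<^sub>m 1\<^sub>m n"
      using schur_scalar[OF \<rho> n twirl_carrier intertwines_twirl[OF n n matrix_unit_carrier]] by blast
    have entry: "twirl n n \<rho> \<rho> (matrix_unit n n i k) $$ (i, k) = (if i = k then c else 0)"
      using ik by (simp add: c)
    show ?thesis
    proof (cases "i = k")
      case True
      have "trace (matrix_unit n n i k) = 1"
        using ik True by (simp add: trace_def matrix_unit_def)
      then have "of_nat n * c = ?c"
        using trace_twirl[OF n matrix_unit_carrier, of i k] by (simp add: c trace_def)
      then show ?thesis unfolding entry using True n0 by (simp add: field_simps)
    qed (simp add: entry)
  qed
  then have "(\<Sum>i<n. \<Sum>k<n. twirl n n \<rho> \<rho> (matrix_unit n n i k) $$ (i, k)) = (\<Sum>i<n. ?c / of_nat n)"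
    by simp
  then show ?thesis
    unfolding sum_char_product[OF n n] using n0 by simp
qed

lemma rep_iso_refl:
  assumes "is_rep G n \<rho>"
  shows "rep_iso G \<rho> \<rho>"
  unfolding rep_iso_def
proof (intro exI ballI)
  fix g assume "g \<in> carrier G"
  with assms have "\<rho> g \<in> carrier_mat n n" by (rule is_rep_carrier)
  then show "similar_mat_wit (\<rho> g) (\<rho> g) (1\<^sub>m n) (1\<^sub>m n)"
    by (intro similar_mat_witI[of _ _ n]) (simp_all add: left_mult_one_mat[of _ n n] right_mult_one_mat[of _ n n])
qed

lemma representatives_orthogonal:
  assumes R: "irrep_representatives G R" and "r \<in> R" "s \<in> R"
  shows "(\<Sum>g\<in>carrier G. rep_char r g * rep_char s (inv g))
       = (if r = s then of_nat (card (carrier G)) else 0)"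
proof (cases "r = s")
  case False
  have irr: "is_irrep G r" "is_irrep G s" using assms by (auto simp: irrep_representatives_def)
  then have "rep_iso G r r" using is_irrep_is_rep rep_iso_refl by blast
  have "\<not> rep_iso G r s"
  proof
    assume "rep_iso G r s"
    moreover have "\<exists>!\<tau>. \<tau> \<in> R \<and> rep_iso G r \<tau>"
      using R irr(1) by (simp add: irrep_representatives_def)
    ultimately show False
      using \<open>rep_iso G r r\<close> assms(2,3) False by auto
  qed
  then show ?thesis using char_orthogonal[OF irr] False by simp
qed (use assms in \<open>simp add: char_norm irrep_representatives_def\<close>)

section \<open>Coefficients with respect to irreducible characters\<close>

lemma coefficient_inversion:
  assumes R: "irrep_representatives G R" "finite R" and s: "s \<in> R"
    and f: "\<And>g. g \<in> carrier G \<Longrightarrow> f g = (\<Sum>r\<in>R. c r * rep_char r g)"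
  shows "(\<Sum>g\<in>carrier G. f g * rep_char s (inv g)) = of_nat (card (carrier G)) * c s"
proof -
  have "(\<Sum>g\<in>carrier G. f g * rep_char s (inv g))
      = (\<Sum>g\<in>carrier G. \<Sum>r\<in>R. c r * (rep_char r g * rep_char s (inv g)))"
    by (simp add: f sum_distrib_right mult.assoc)
  also have "\<dots> = (\<Sum>r\<in>R. c r * (\<Sum>g\<in>carrier G. rep_char r g * rep_char s (inv g)))"
    unfolding sum_distrib_left by (rule sum.swap)
  also have "\<dots> = (\<Sum>r\<in>R. if r = s then of_nat (card (carrier G)) * c s else 0)"
    by (intro sum.cong refl) (simp add: representatives_orthogonal[OF R(1) _ s])
  finally show ?thesis using s R(2) by simp
qed

lemma sum_in_nonneg_Reals:
  "(\<And>x. x \<in> A \<Longrightarrow> f x \<in> \<real>\<^sub>\<ge>\<^sub>0) \<Longrightarrow> sum f A \<in> \<real>\<^sub>\<ge>\<^sub>0"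
  by (induction A rule: infinite_finite_induct) auto

text \<open>
  Inserting \<open>f * f = (\<Sum>a b. c\<^sub>a c\<^sub>b \<chi>\<^sub>a \<chi>\<^sub>b)\<close> into the inversion formula for \<open>d\<^sub>s\<close> gives
  \<open>d\<^sub>s = (\<Sum>a b. c\<^sub>a c\<^sub>b N\<^sub>a\<^sub>b)\<close> with the natural numbers \<open>N\<^sub>a\<^sub>b\<close> of \<open>sum_char_triple\<close>.
\<close>

lemma square_coefficients_nonneg:
  assumes fin: "finite (carrier G)" and R: "irrep_representatives G R" "finite R" and s: "s \<in> R"
    and f: "\<And>g. g \<in> carrier G \<Longrightarrow> f g = (\<Sum>r\<in>R. c r * rep_char r g)"
    and f2: "\<And>g. g \<in> carrier G \<Longrightarrow> f g * f g = (\<Sum>r\<in>R. d r * rep_char r g)"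
    and c: "\<And>r. r \<in> R \<Longrightarrow> c r \<in> \<real>\<^sub>\<ge>\<^sub>0"
  shows "d s \<in> \<real>\<^sub>\<ge>\<^sub>0"
proof -
  let ?n = "of_nat (card (carrier G)) :: complex"
  have n0: "?n \<noteq> 0" using fin by auto
  have "\<exists>k. (\<Sum>g\<in>carrier G. rep_char a g * rep_char b g * rep_char s (inv g)) = ?n * of_nat k"
    if "a \<in> R" "b \<in> R" for a b
  proof -
    have rep: "\<exists>n. is_rep G n r" if "r \<in> R" for r
      using R(1) that is_irrep_is_rep by (simp add: irrep_representatives_def)
    obtain na nb ns where "is_rep G na a" "is_rep G nb b" "is_rep G ns s"
      using rep[OF \<open>a \<in> R\<close>] rep[OF \<open>b \<in> R\<close>] rep[OF s] by blast
    then show ?thesis by (rule sum_char_triple[OF fin])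
  qed
  then obtain N :: "_ \<Rightarrow> _ \<Rightarrow> nat" where
    N: "\<And>a b. a \<in> R \<Longrightarrow> b \<in> R \<Longrightarrow>
      (\<Sum>g\<in>carrier G. rep_char a g * rep_char b g * rep_char s (inv g)) = ?n * of_nat (N a b)"
    by metis
  have "?n * d s = (\<Sum>g\<in>carrier G. (f g * f g) * rep_char s (inv g))"
    using coefficient_inversion[OF R s f2] by simp
  also have "\<dots> = (\<Sum>g\<in>carrier G. \<Sum>a\<in>R. \<Sum>b\<in>R.
      c a * c b * (rep_char a g * rep_char b g * rep_char s (inv g)))"
  proof (rule sum.cong[OF refl])
    fix g assume g: "g \<in> carrier G"
    have "(f g * f g) * rep_char s (inv g)
        = (\<Sum>a\<in>R. \<Sum>b\<in>R. (c a * rep_char a g) * (c b * rep_char b g) * rep_char s (inv g))"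
      unfolding f[OF g] sum_product by (simp only: sum_distrib_right)
    then show "(f g * f g) * rep_char s (inv g)
        = (\<Sum>a\<in>R. \<Sum>b\<in>R. c a * c b * (rep_char a g * rep_char b g * rep_char s (inv g)))"
      by (simp only: mult_ac)
  qed
  also have "\<dots> = (\<Sum>a\<in>R. \<Sum>g\<in>carrier G. \<Sum>b\<in>R.
      c a * c b * (rep_char a g * rep_char b g * rep_char s (inv g)))"
    by (rule sum.swap)
  also have "\<dots> = (\<Sum>a\<in>R. \<Sum>b\<in>R. c a * c b *
      (\<Sum>g\<in>carrier G. rep_char a g * rep_char b g * rep_char s (inv g)))"
    unfolding sum_distrib_left by (rule sum.cong[OF refl], rule sum.swap)
  also have "\<dots> = (\<Sum>a\<in>R. \<Sum>b\<in>R. ?n * (c a * c b * of_nat (N a b)))"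
    by (intro sum.cong refl) (simp add: N)
  also have "\<dots> = ?n * (\<Sum>a\<in>R. \<Sum>b\<in>R. c a * c b * of_nat (N a b))"
    by (simp only: sum_distrib_left)
  finally have "d s = (\<Sum>a\<in>R. \<Sum>b\<in>R. c a * c b * of_nat (N a b))"
    using n0 by simp
  then show ?thesis
    using c by (auto intro!: sum_in_nonneg_Reals)
qed

end

section \<open>From small times to all times\<close>

lemma nonneg_propagates_by_doubling:
  fixes P :: "real \<Rightarrow> bool"
  assumes "\<epsilon> > 0" and small: "\<And>t. 0 \<le> t \<Longrightarrow> t \<le> \<epsilon> \<Longrightarrow> P t"
    and double: "\<And>t. 0 \<le> t \<Longrightarrow> P t \<Longrightarrow> P (2 * t)" and "0 \<le> t"
  shows "P t"
proof -
  have *: "P t" if "0 \<le> t" "t \<le> 2 ^ k * \<epsilon>" for k t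
    using that
  proof (induction k arbitrary: t)
    case (Suc k)
    then have "P (t / 2)" by simp
    then show ?case using double[of "t / 2"] Suc.prems by simp
  qed (simp add: small)
  obtain k where "t / \<epsilon> < 2 ^ k" using real_arch_pow[of 2 "t / \<epsilon>"] by auto
  then have "t \<le> 2 ^ k * \<epsilon>" using \<open>\<epsilon> > 0\<close> by (simp add: field_simps)
  then show ?thesis using * \<open>0 \<le> t\<close> by blast
qed

theorem theorem3p1:
  fixes G :: "('g, 'b) monoid_scheme" (structure)
    and len :: "'g \<Rightarrow> real"
    and R :: "('g \<Rightarrow> complex mat) set"
    and p :: "('g \<Rightarrow> complex mat) \<Rightarrow> real \<Rightarrow> complex"
  assumes "group G" and "finite (carrier G)"
    and len_nonneg: "\<And>g. g \<in> carrier G \<Longrightarrow> 0 \<le> len g"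
    and len_class: "\<And>g h. g \<in> carrier G \<Longrightarrow> h \<in> carrier G \<Longrightarrow> len (h \<otimes> g \<otimes> inv h) = len g"
    and len_one: "len \<one> = 0"
    and len_inv: "\<And>g. g \<in> carrier G \<Longrightarrow> len (inv g) = len g"
    and irreps: "irrep_representatives G R"
    and decomposition: "\<And>t v. 0 \<le> t \<Longrightarrow> v \<in> group_algebra G \<Longrightarrow>
          semigroup_op len t v = (\<lambda>g. \<Sum>r\<in>R. p r t * sigma_op r v g)"
    and small_times: "\<exists>\<epsilon>>0. \<forall>r\<in>R. \<forall>t. 0 \<le> t \<and> t \<le> \<epsilon> \<longrightarrow> p r t \<in> \<real>\<^sub>\<ge>\<^sub>0"
  shows "\<forall>s\<in>R. \<forall>t\<ge>0. p s t \<in> \<real>\<^sub>\<ge>\<^sub>0"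
proof -
  interpret group G by fact
  define f :: "real \<Rightarrow> 'g \<Rightarrow> complex" where "f t g = of_real (exp (- t * len g))" for t g
  have f: "f t g = (\<Sum>r\<in>R. p r t * rep_char r g)" if "0 \<le> t" "g \<in> carrier G" for t g
  proof -
    \<comment> \<open>The coefficient of \<open>ket g\<close> in the identity applied to \<open>ket g\<close>.\<close>
    have "ket g \<in> group_algebra G" using that by (auto simp: ket_def group_algebra_def)
    from fun_cong[OF decomposition[OF that(1) this], of g] show ?thesis
      by (simp add: f_def semigroup_op_def sigma_op_def ket_def)
  qed
  \<comment> \<open>Over an infinite \<open>R\<close> the sum would be \<open>0\<close>, whereas at time \<open>0\<close> it equals \<open>1\<close>.\<close>
  have "finite R"
    using f[of 0 \<one>] by (auto simp: f_def intro: ccontr)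
  have sq: "f t g * f t g = f (2 * t) g" for t g
    by (simp add: f_def of_real_mult[symmetric] exp_add[symmetric] del: of_real_mult)
  obtain \<epsilon> where \<epsilon>: "\<epsilon> > 0" "\<And>r t. r \<in> R \<Longrightarrow> 0 \<le> t \<Longrightarrow> t \<le> \<epsilon> \<Longrightarrow> p r t \<in> \<real>\<^sub>\<ge>\<^sub>0"
    using small_times by blast
  have "\<forall>s\<in>R. p s t \<in> \<real>\<^sub>\<ge>\<^sub>0" if "0 \<le> t" for t
    using \<epsilon>(1)
  proof (rule nonneg_propagates_by_doubling)
    fix t :: real assume t: "0 \<le> t" "\<forall>s\<in>R. p s t \<in> \<real>\<^sub>\<ge>\<^sub>0"
    show "\<forall>s\<in>R. p s (2 * t) \<in> \<real>\<^sub>\<ge>\<^sub>0"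
    proof
      fix s assume "s \<in> R"
      then show "p s (2 * t) \<in> \<real>\<^sub>\<ge>\<^sub>0"
      proof (rule square_coefficients_nonneg[OF assms(2) irreps \<open>finite R\<close>])
        fix g assume g: "g \<in> carrier G"
        show "f t g = (\<Sum>r\<in>R. p r t * rep_char r g)"
          using t(1) g by (rule f)
        show "f t g * f t g = (\<Sum>r\<in>R. p r (2 * t) * rep_char r g)"
          unfolding sq using t(1) g by (intro f) simp_all
      qed (use t(2) in blast)
    qed
  qed (use \<epsilon>(2) that in auto)
  then show ?thesis by blast
qed

end
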